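(* Let $k,k_1,k_2\in\mathbb{Z}_{\geq0}$. For each of the following five data (equation; $B$; $\mathbf{Z}=(Z_1,Z_2)$; $D$), consider the generalized cluster pattern $CP_{(\mathbf{x},B,\mathbf{Z})}$ of rank $2$ with initial cluster $\mathbf{x}=(x_1,x_2)$: (i) $x^2+y^2+1=3xy$; $B=\begin{bmatrix}0&2\\-2&0\end{bmatrix}$; $Z_1=Z_2=1+u$; $D=I_2$. (ii) $x^2+y^2+k_1x+1=(3+k_1)xy$; $B=\begin{bmatrix}0&1\\-2&0\end{bmatrix}$; $Z_1=1+u$, $Z_2=1+k_1u+u^2$; $D=\mathrm{diag}(1,2)$. (iii) $x^2+y^2+k_1x+k_2y+1=(3+k_1+k_2)xy$; $B=\begin{bmatrix}0&1\\-1&0\end{bmatrix}$; $Z_1=1+k_2u+u^2$, $Z_2=1+k_1u+u^2$; $D=\mathrm{diag}(2,2)$. (iv) $x^2+y^4+2x+1=5xy^2$; $B=\begin{bmatrix}0&1\\-4&0\end{bmatrix}$; $Z_1=Z_2=1+u$; $D=I_2$. (v) $x^2+y^4+ky^2+2x+1=(5+k)xy^2$; $B=\begin{bmatrix}0&1\\-2&0\end{bmatrix}$; $Z_1=1+ku+u^2$, $Z_2=1+u$; $D=\mathrm{diag}(2,1)$. Then in each case, ignoring exchange matrices and keeping only clusters, the clusters $(x_{1;t},x_{2;t})$, $t\in\mathbb{T}_2$, specialized at $x_1=x_2=1$, give the tree of all positive integer solutions $(x,y)$ of the corresponding equation; that is, the set $\{(x_{1;t},x_{2;t})|_{x_1=x_2=1}: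 t\in\mathbb{T}_2\}$ is exactly the set of positive integer solutions $(x,y)$ of the corresponding equation.
   Context: Generalized cluster patterns (rank $n$). Let $\mathcal{F}$ be the field of rational functions in $n$ indeterminates. A labeled seed is a triple $(\mathbf{x},B,\mathbf{Z})$ where $\mathbf{x}=(x_1,\dots,x_n)$ is a free generating set of $\mathcal{F}$, $B=(b_{ij})$ is an $n\times n$ skew-symmetrizable integer matrix, and $\mathbf{Z}=(Z_1,\dots,Z_n)$ with $Z_i(u)=z_{i,0}+z_{i,1}u+\dots+z_{i,d_i}u^{d_i}$, coefficients in $\mathbb{R}_{>0}$, $z_{i,0}=z_{i,d_i}=1$; $D=\mathrm{diag}(d_1,\dots,d_n)$. Write $[b]_+=\max(b,0)$. The mutation $\mu_k$ sends $(\mathbf{x},B,\mathbf{Z})$ to $(\mathbf{x}',B',\mathbf{Z}')$ where $b'_{ij}=-b_{ij}$ if $i=k$ or $j=k$, and $b'_{ij}=b_{ij}+d_k([b_{ik}]_+b_{kj}+b_{ik}[-b_{kj}]_+)$ otherwise; $x'_k=\left(\prod_{i}x_i^{[-b_{ik}]_+}\right)^{d_k}Z_k\!\left(\prod_i x_i^{b_{ik}}\right)/x_k$ and $x'_j=x_j$ for $j\ne k$; $Z'_k(u)=u^{d_k}Z_k(u^{-1})$ and $Z'_j=Z_j$ for $j\neq k$. Let $\mathbb{T}_n$ be the $n$-regular tree with edges labeled $1,\dots,n$ so that the edges at each vertex have distinct labels (for $n=2$ an infinite path with alternating labels), with a fixed rooted vertex $t_0$. The generalized cluster pattern $CP_{(\mathbf{x},B,\mathbf{Z})}$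 assigns a labeled seed $\Sigma_t=(\mathbf{x}_t,B_t,\mathbf{Z}_t)$, $\mathbf{x}_t=(x_{1;t},\dots,x_{n;t})$, to each $t\in\mathbb{T}_n$ with $\Sigma_{t_0}=(\mathbf{x},B,\mathbf{Z})$ and $\Sigma_{t'}=\mu_k(\Sigma_t)$ whenever $t,t'$ are joined by an edge labeled $k$. *)

theory Defs
  imports
    "HOL-Analysis.Cartesian_Space"
    "HOL-Library.Poly_Mapping"
    "HOL-Computational_Algebra.Fraction_Field"
    "HOL-Computational_Algebra.Polynomial"
begin

text \<open>
  The rank is \<open>n = CARD('n)\<close>.  The linear order on the index type plays no role in the mathematics;
  the instance of \<^class>\<open>idom\<close> for \<^type>\<open>poly_mapping\<close> asks for it.  The ground field is
  the reals, because the polynomials of a seed have real coefficients.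
\<close>

type_synonym 'n mpoly = "('n \<Rightarrow>\<^sub>0 nat) \<Rightarrow>\<^sub>0 real"
type_synonym 'n ratfun = "(('n \<Rightarrow>\<^sub>0 nat) \<Rightarrow>\<^sub>0 real) fract"

definition ratfun_const :: "real \<Rightarrow> ('n::{finite,linorder}) ratfun" where
  "ratfun_const c = Fract (Poly_Mapping.single 0 c) 1"

definition eval_mpoly ::
  "(real \<Rightarrow> 'b::comm_ring_1) \<Rightarrow> ('b, 'n::finite) vec \<Rightarrow> 'n mpoly \<Rightarrow> 'b" where
  "eval_mpoly h x p = (\<Sum>m \<in> Poly_Mapping.keys p.
     h (Poly_Mapping.lookup p m) * (\<Prod>i\<in>UNIV. (x $ i) ^ Poly_Mapping.lookup m i))"

definition free_generating_set :: "('n ratfun, 'n::{finite,linorder}) vec \<Rightarrow> bool" where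
  "free_generating_set x \<longleftrightarrow>
     (\<forall>p. eval_mpoly ratfun_const x p = 0 \<longrightarrow> p = 0) \<and>
     (\<forall>f. \<exists>p q. eval_mpoly ratfun_const x q \<noteq> 0 \<and>
                f = eval_mpoly ratfun_const x p / eval_mpoly ratfun_const x q)"

text \<open>
  Specialization of \<open>f\<close> at \<open>x = a\<close>: write \<open>f\<close> as a quotient \<open>p(x) / q(x)\<close> of polynomials in \<open>x\<close>
  whose denominator does not vanish at \<open>a\<close>, and substitute \<open>a\<close> for \<open>x\<close>.  For a free generating
  set \<open>x\<close> the value does not depend on the choice of \<open>p\<close> and \<open>q\<close>; it is meaningful only if \<open>f\<close> is
  regular at \<open>a\<close>, that is, if such \<open>p\<close> and \<open>q\<close> exist.
\<close>

definition specializes_to ::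
  "('n ratfun, 'n::{finite,linorder}) vec \<Rightarrow> (real, 'n) vec \<Rightarrow> 'n ratfun \<Rightarrow> real \<Rightarrow> bool" where
  "specializes_to x a f v \<longleftrightarrow> (\<exists>p q.
     eval_mpoly ratfun_const x q \<noteq> 0 \<and>
     f = eval_mpoly ratfun_const x p / eval_mpoly ratfun_const x q \<and>
     eval_mpoly id a q \<noteq> 0 \<and>
     v = eval_mpoly id a p / eval_mpoly id a q)"

definition regular_at ::
  "('n ratfun, 'n::{finite,linorder}) vec \<Rightarrow> (real, 'n) vec \<Rightarrow> 'n ratfun \<Rightarrow> bool" where
  "regular_at x a f \<longleftrightarrow> (\<exists>v. specializes_to x a f v)"

definition specialize ::
  "('n ratfun, 'n::{finite,linorder}) vec \<Rightarrow> (real, 'n) vec \<Rightarrow> 'n ratfun \<Rightarrow> real" where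
  "specialize x a f = (THE v. specializes_to x a f v)"

text \<open>
  The degrees \<open>d\<^sub>i\<close> are not a separate component of a seed: since the leading coefficient of \<open>Z\<^sub>i\<close> is 1,
  \<open>d\<^sub>i\<close> is the degree of \<open>Z\<^sub>i\<close>.
\<close>

record (overloaded) ('n::"{finite,linorder}") seed =
  cluster :: "('n ratfun, 'n) vec"
  exch :: "((int, 'n) vec, 'n) vec"
  polys :: "(real poly, 'n) vec"

definition dg :: "('n::{finite,linorder}) seed \<Rightarrow> 'n \<Rightarrow> nat" where
  "dg s i = degree (polys s $ i)"

abbreviation pos_part :: "int \<Rightarrow> int" where
  "pos_part b \<equiv> max b 0"

definition mutate_exch :: "'n \<Rightarrow> ('n::{finite,linorder}) seed \<Rightarrow> ((int, 'n) vec, 'n) vec" where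
  "mutate_exch k s = (let B = exch s in
     \<chi> i j. if i = k \<or> j = k then - (B $ i $ j)
            else B $ i $ j + int (dg s k) *
              (pos_part (B $ i $ k) * B $ k $ j + B $ i $ k * pos_part (- (B $ k $ j))))"

definition mutate_cluster :: "'n \<Rightarrow> ('n::{finite,linorder}) seed \<Rightarrow> ('n ratfun, 'n) vec" where
  "mutate_cluster k s = (let x = cluster s; B = exch s in
     \<chi> j. if j = k
           then (\<Prod>i\<in>UNIV. (x $ i) powi pos_part (- (B $ i $ k))) ^ dg s k *
                poly (map_poly ratfun_const (polys s $ k)) (\<Prod>i\<in>UNIV. (x $ i) powi (B $ i $ k)) /
                x $ k
           else x $ j)"

text \<open>
  \<^const>\<open>reflect_poly\<close> maps \<open>Z\<close> to \<open>u\<^sup>d Z(1/u)\<close>, where \<open>d = degree Z\<close>.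
\<close>

definition mutate_polys :: "'n \<Rightarrow> ('n::{finite,linorder}) seed \<Rightarrow> (real poly, 'n) vec" where
  "mutate_polys k s = (\<chi> j. if j = k then reflect_poly (polys s $ k) else polys s $ j)"

definition mutate :: "'n \<Rightarrow> ('n::{finite,linorder}) seed \<Rightarrow> 'n seed" where
  "mutate k s = \<lparr>cluster = mutate_cluster k s, exch = mutate_exch k s, polys = mutate_polys k s\<rparr>"

text \<open>
  The vertices of the \<open>n\<close>-regular tree are the words over the labels without two equal adjacent
  letters: a word lists the edge labels, last edge first, on the path from the root \<open>[]\<close> to the
  vertex, and an edge labelled \<open>k\<close> joins \<open>t\<close> and \<open>k # t\<close>.
\<close>

definition tree_vertices :: "'n list set" where
  "tree_vertices = {t. distinct_adj t}"

text \<open>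
  Every edge of the tree is of the form \<open>{t, k # t}\<close>, and mutation in direction \<open>k\<close> is an involution
  on labeled seeds, so the recursion below is the relation between the seeds at adjacent vertices.
\<close>

primrec cluster_pattern :: "('n::{finite,linorder}) seed \<Rightarrow> 'n list \<Rightarrow> 'n seed" where
  "cluster_pattern s [] = s"
| "cluster_pattern s (k # t) = mutate k (cluster_pattern s t)"

text \<open>
  The clusters of the rank 2 pattern with initial seed \<open>s\<close>, specialized at \<open>x\<^sub>1 = x\<^sub>2 = 1\<close> (where all
  cluster variables are regular), are exactly the positive integer solutions of \<open>E\<close>.  The indices
  are \<open>1, 2 :: 2\<close>; in this type \<open>2 = 0\<close>.
\<close>

definition clusters_give_solutions :: "2 seed \<Rightarrow> (int \<Rightarrow> int \<Rightarrow> bool) \<Rightarrow> bool" where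
  "clusters_give_solutions s E \<longleftrightarrow>
     (\<forall>t \<in> tree_vertices. \<forall>i. regular_at (cluster s) 1 (cluster (cluster_pattern s t) $ i)) \<and>
     {(specialize (cluster s) 1 (cluster (cluster_pattern s t) $ 1),
       specialize (cluster s) 1 (cluster (cluster_pattern s t) $ 2)) | t. t \<in> tree_vertices} =
     {(of_int a, of_int b) | a b. 0 < a \<and> 0 < b \<and> E a b}"

end

theory Submission
  imports Defs
begin

text \<open>
  Since the exchange polynomials are palindromic, a mutation changes the exchange matrix only by a
  sign and leaves the exchange relations unchanged; after specialization these are the Vieta
  involutions of the equation, \<open>u u' = P v\<close> and \<open>v v' = Q u\<close>.  Unless \<open>(u, v) = (1, 1)\<close>, one of the
  two involutions makes a positive solution smaller, so descent reaches every solution from \<open>(1, 1)\<close>.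
\<close>

section \<open>Specialization of rational functions\<close>

lemma eval_mpoly_add:
  assumes "h 0 = 0" and "\<And>c d. h (c + d) = h c + h d"
  shows "eval_mpoly h x (p + q) = eval_mpoly h x p + eval_mpoly h x q"
  unfolding eval_mpoly_def
  by (rule setsum_keys_plus_distrib) (simp_all add: assms algebra_simps)

lemma eval_mpoly_single:
  assumes "h 0 = 0"
  shows "eval_mpoly h x (Poly_Mapping.single m c) =
    h c * (\<Prod>i\<in>UNIV. (x $ i) ^ Poly_Mapping.lookup m i)"
  using assms by (cases "c = 0") (simp_all add: eval_mpoly_def)

text \<open>Building a polynomial up monomial by monomial reduces multiplicativity of evaluation to
  the product of two monomials, since both sides are additive in each factor.\<close>

lemma poly_mapping_single_induct [case_names zero add]:
  assumes "P 0"
    and "\<And>m c f. P f \<Longrightarrow> P (Poly_Mapping.single m c + f)"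
  shows "P f"
proof (induction f rule: update_induct)
  case const
  then show ?case by fact
next
  case (update f a b)
  have "Poly_Mapping.update a b f = Poly_Mapping.single a b + f"
    using update(1)
    by (intro poly_mapping_eqI) (auto simp: lookup_update lookup_add lookup_single in_keys_iff when_def)
  with assms(2)[OF update(3)] show ?case by simp
qed

lemma eval_mpoly_mult:
  fixes p q :: "'n::finite mpoly"
  assumes h0: "h 0 = 0" and hadd: "\<And>c d. h (c + d) = h c + h d"
    and hmult: "\<And>c d. h (c * d) = h c * h d"
  shows "eval_mpoly h x (p * q) = eval_mpoly h x p * eval_mpoly h x q"
proof -
  note add_hom = eval_mpoly_add[of h, OF h0 hadd]
  have zero: "eval_mpoly h x 0 = 0"
    by (simp add: eval_mpoly_def)
  have single: "eval_mpoly h x (Poly_Mapping.single m c * q) =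
      eval_mpoly h x (Poly_Mapping.single m c) * eval_mpoly h x q" for m c
  proof (induction q rule: poly_mapping_single_induct)
    case (add m' c' f)
    then show ?case
      by (simp add: add_hom distrib_left mult_single eval_mpoly_single h0 hmult lookup_add power_add
          prod.distrib mult_ac)
  qed (simp add: zero)
  show ?thesis
    by (induction p rule: poly_mapping_single_induct) (simp_all add: zero add_hom single distrib_right)
qed

lemma ratfun_const_hom:
  "ratfun_const 0 = 0" "ratfun_const 1 = 1"
  "ratfun_const (c + d) = ratfun_const c + ratfun_const d"
  "ratfun_const (c * d) = ratfun_const c * ratfun_const d"
  by (simp_all add: ratfun_const_def fract_collapse single_add mult_single)

lemmas eval_ratfun_mult = eval_mpoly_mult[of ratfun_const, OF ratfun_const_hom(1,3,4)]
lemmas eval_ratfun_add = eval_mpoly_add[of ratfun_const, OF ratfun_const_hom(1,3)]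

lemma eval_id_mult: "eval_mpoly id a (p * q) = eval_mpoly id a p * eval_mpoly id a q"
  by (rule eval_mpoly_mult) simp_all

lemma eval_id_add: "eval_mpoly id a (p + q) = eval_mpoly id a p + eval_mpoly id a q"
  by (rule eval_mpoly_add) simp_all

lemma eval_mpoly_const:
  assumes "h 0 = 0"
  shows "eval_mpoly h x (Poly_Mapping.single 0 c) = h c"
  using assms by (simp add: eval_mpoly_single)

lemma eval_mpoly_one:
  assumes "h 0 = 0" "h 1 = 1"
  shows "eval_mpoly h x 1 = 1"
  using eval_mpoly_const[of h x 1] assms by simp

section \<open>Arithmetic of specialized values\<close>

lemma specializes_to_const: "specializes_to x a (ratfun_const c) c"
  unfolding specializes_to_def
  by (intro exI[of _ "Poly_Mapping.single 0 c"] exI[of _ 1])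
    (simp add: eval_mpoly_one eval_mpoly_const ratfun_const_hom)

lemma specializes_to_one: "specializes_to x a 1 1"
  using specializes_to_const[of x a 1] by (simp add: ratfun_const_hom)

lemma eval_mpoly_var:
  fixes x :: "('b::comm_ring_1, 'n::finite) vec"
  assumes "h 0 = 0" "h 1 = 1"
  shows "eval_mpoly h x (Poly_Mapping.single (Poly_Mapping.single i 1) 1) = x $ i"
proof -
  have "(\<Prod>j\<in>UNIV. (x $ j) ^ (Poly_Mapping.lookup (Poly_Mapping.single i 1) j)) =
      (\<Prod>j\<in>UNIV. if j = i then x $ j else 1)"
    by (intro prod.cong) (auto simp: lookup_single when_def)
  with assms show ?thesis
    by (simp add: eval_mpoly_single del: prod_zero_iff)
qed

lemma specializes_to_var: "specializes_to x a (x $ i) (a $ i)"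
  unfolding specializes_to_def
  by (intro exI[of _ "Poly_Mapping.single (Poly_Mapping.single i 1) 1"] exI[of _ 1])
    (simp add: eval_mpoly_one eval_mpoly_var[unfolded One_nat_def] ratfun_const_hom)

lemma specializes_to_add:
  assumes "specializes_to x a f v" "specializes_to x a g w"
  shows "specializes_to x a (f + g) (v + w)"
proof -
  obtain p q p' q' where
    "eval_mpoly ratfun_const x q \<noteq> 0" "eval_mpoly ratfun_const x q' \<noteq> 0"
    "f = eval_mpoly ratfun_const x p / eval_mpoly ratfun_const x q"
    "g = eval_mpoly ratfun_const x p' / eval_mpoly ratfun_const x q'"
    "eval_mpoly id a q \<noteq> 0" "eval_mpoly id a q' \<noteq> 0"
    "v = eval_mpoly id a p / eval_mpoly id a q" "w = eval_mpoly id a p' / eval_mpoly id a q'"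
    using assms unfolding specializes_to_def by blast
  then show ?thesis
    unfolding specializes_to_def
    by (intro exI[of _ "p * q' + p' * q"] exI[of _ "q * q'"])
      (simp add: eval_ratfun_mult eval_ratfun_add eval_id_mult eval_id_add add_frac_eq)
qed

lemma specializes_to_mult:
  assumes "specializes_to x a f v" "specializes_to x a g w"
  shows "specializes_to x a (f * g) (v * w)"
proof -
  obtain p q p' q' where
    "eval_mpoly ratfun_const x q \<noteq> 0" "eval_mpoly ratfun_const x q' \<noteq> 0"
    "f = eval_mpoly ratfun_const x p / eval_mpoly ratfun_const x q"
    "g = eval_mpoly ratfun_const x p' / eval_mpoly ratfun_const x q'"
    "eval_mpoly id a q \<noteq> 0" "eval_mpoly id a q' \<noteq> 0"
    "v = eval_mpoly id a p / eval_mpoly id a q" "w = eval_mpoly id a p' / eval_mpoly id a q'"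
    using assms unfolding specializes_to_def by blast
  then show ?thesis
    unfolding specializes_to_def
    by (intro exI[of _ "p * p'"] exI[of _ "q * q'"])
      (simp add: eval_ratfun_mult eval_id_mult)
qed

text \<open>Inverting swaps numerator and denominator. The new denominator \<open>p\<close> is a
  nonzero polynomial because its value at \<open>a\<close> is nonzero, and algebraic independence of
  \<open>x\<close> keeps it nonzero in the field.\<close>

lemma specializes_to_inverse:
  assumes "free_generating_set x" "specializes_to x a f v" "v \<noteq> 0"
  shows "specializes_to x a (inverse f) (inverse v)"
proof -
  obtain p q where pq: "eval_mpoly ratfun_const x q \<noteq> 0"
    "f = eval_mpoly ratfun_const x p / eval_mpoly ratfun_const x q"
    "eval_mpoly id a q \<noteq> 0" "v = eval_mpoly id a p / eval_mpoly id a q"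
    using assms(2) unfolding specializes_to_def by blast
  have "p \<noteq> 0"
    using pq(4) assms(3) by (auto simp: eval_mpoly_def)
  then have "eval_mpoly ratfun_const x p \<noteq> 0"
    using assms(1) unfolding free_generating_set_def by blast
  with pq assms(3) show ?thesis
    unfolding specializes_to_def
    by (intro exI[of _ q] exI[of _ p]) simp
qed

lemma specializes_to_divide:
  assumes "free_generating_set x" "specializes_to x a f v" "specializes_to x a g w" "w \<noteq> 0"
  shows "specializes_to x a (f / g) (v / w)"
  using specializes_to_mult[OF assms(2) specializes_to_inverse[OF assms(1,3,4)]]
  by (simp add: divide_inverse)

lemma specializes_to_power:
  assumes "specializes_to x a f v"
  shows "specializes_to x a (f ^ n) (v ^ n)"
  by (induction n) (simp_all add: specializes_to_one specializes_to_mult assms)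

lemma specializes_to_power_int:
  assumes "free_generating_set x" "specializes_to x a f v" "v \<noteq> 0"
  shows "specializes_to x a (f powi n) (v powi n)"
  by (simp add: power_int_def specializes_to_power specializes_to_inverse assms)

lemma specializes_to_prod:
  assumes "\<And>i. i \<in> I \<Longrightarrow> specializes_to x a (f i) (v i)"
  shows "specializes_to x a (\<Prod>i\<in>I. f i) (\<Prod>i\<in>I. v i)"
  using assms
  by (induction I rule: infinite_finite_induct) (simp_all add: specializes_to_one specializes_to_mult)

lemma specializes_to_poly:
  assumes "specializes_to x a f v"
  shows "specializes_to x a (poly (map_poly ratfun_const Z) f) (poly Z v)"
proof (induction Z)
  case 0
  then show ?case
    using specializes_to_const[of x a 0] by (simp add: ratfun_const_hom)
next
  case (pCons c Z)
  then show ?case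
    by (simp add: map_poly_pCons ratfun_const_hom specializes_to_add specializes_to_mult
        specializes_to_const assms)
qed

text \<open>Cross-multiplying two representations gives a relation among the entries of
  \<open>x\<close>. By algebraic independence it is an identity of polynomials, so it survives
  substitution of \<open>a\<close>.\<close>

lemma specializes_to_unique:
  assumes "free_generating_set x" "specializes_to x a f v" "specializes_to x a f w"
  shows "v = w"
proof -
  obtain p q p' q' where pq:
    "eval_mpoly ratfun_const x q \<noteq> 0" "eval_mpoly ratfun_const x q' \<noteq> 0"
    "f = eval_mpoly ratfun_const x p / eval_mpoly ratfun_const x q"
    "f = eval_mpoly ratfun_const x p' / eval_mpoly ratfun_const x q'"
    "eval_mpoly id a q \<noteq> 0" "eval_mpoly id a q' \<noteq> 0"
    "v = eval_mpoly id a p / eval_mpoly id a q" "w = eval_mpoly id a p' / eval_mpoly id a q'"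
    using assms(2,3) unfolding specializes_to_def by blast
  let ?r = "p * q' + - (p' * q)"
  have eval_minus: "eval_mpoly ratfun_const x (- r) = - eval_mpoly ratfun_const x r" for r
    using eval_ratfun_add[of x r "- r"] by (simp add: eval_mpoly_def eq_neg_iff_add_eq_0 add.commute)
  have "eval_mpoly ratfun_const x p * eval_mpoly ratfun_const x q' =
      eval_mpoly ratfun_const x p' * eval_mpoly ratfun_const x q"
    using pq by (simp add: frac_eq_eq)
  then have "eval_mpoly ratfun_const x ?r = 0"
    by (simp only: eval_ratfun_add eval_minus eval_ratfun_mult) simp
  then have "?r = 0"
    using assms(1) unfolding free_generating_set_def by blast
  then have "p * q' = p' * q"
    by simp
  then have "eval_mpoly id a p * eval_mpoly id a q' = eval_mpoly id a p' * eval_mpoly id a q"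
    by (simp flip: eval_id_mult)
  with pq show ?thesis
    by (simp add: frac_eq_eq)
qed

lemma specialize_eqI:
  assumes "free_generating_set x" "specializes_to x a f v"
  shows "specialize x a f = v"
  unfolding specialize_def
  using assms by (blast intro: the_equality specializes_to_unique)

text \<open>The exchange relation involves only field operations, so it passes to values.
  Nonvanishing of the values covers both the division by the old variable and the negative
  exponents.\<close>

lemma specializes_to_mutate_cluster:
  assumes free: "free_generating_set x"
    and val: "\<And>i. specializes_to x a (cluster s $ i) (v $ i)"
    and nz: "\<And>i. v $ i \<noteq> 0"
  shows "specializes_to x a (mutate_cluster k s $ j)
    (if j = k
     then (\<Prod>i\<in>UNIV. (v $ i) powi pos_part (- (exch s $ i $ k))) ^ dg s k *
          poly (polys s $ k) (\<Prod>i\<in>UNIV. (v $ i) powi (exch s $ i $ k)) / v $ k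
     else v $ j)"
  by (simp add: mutate_cluster_def Let_def val nz free specializes_to_divide specializes_to_mult
      specializes_to_power specializes_to_poly specializes_to_prod specializes_to_power_int)

section \<open>Rank two patterns with palindromic exchange polynomials\<close>

lemma prod_UNIV_2: "(\<Prod>i\<in>(UNIV::2 set). f i) = f 1 * f 2"
  by (simp add: UNIV_2)

lemma vec_2_eq_iff: "(v::('a, 2) vec) = w \<longleftrightarrow> v $ 1 = w $ 1 \<and> v $ 2 = w $ 2"
  by (simp add: vec_eq_iff forall_2)

text \<open>Mutation on specialized values, written without signs: \<open>c\<close> and
  \<open>b\<close> are the absolute values of the off-diagonal entries in columns 1 and 2 of the
  exchange matrix.\<close>

definition exchange_step ::
  "nat \<Rightarrow> nat \<Rightarrow> real poly \<Rightarrow> real poly \<Rightarrow> 2 \<Rightarrow> real \<times> real \<Rightarrow> real \<times> real" where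
  "exchange_step b c Z1 Z2 k p =
     (if k = 1 then (poly Z1 (snd p ^ c) / fst p, snd p)
      else (fst p, poly Z2 (fst p ^ b) / snd p))"

definition rank2_seed ::
  "(2 ratfun, 2) vec \<Rightarrow> nat \<Rightarrow> nat \<Rightarrow> real poly \<Rightarrow> real poly \<Rightarrow> 2 seed" where
  "rank2_seed x b c Z1 Z2 =
     \<lparr>cluster = x, exch = vector [vector [0, int b], vector [- int c, 0]], polys = vector [Z1, Z2]\<rparr>"

text \<open>This is why the sign of the exchange matrix does not affect the exchange
  relation.\<close>

lemma palindromic_poly_inverse:
  fixes u :: real
  assumes "reflect_poly Z = Z" "u \<noteq> 0"
  shows "u ^ degree Z * poly Z (inverse u) = poly Z u"
  using poly_reflect_poly_nz[of u Z] assms by simp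

text \<open>The induction carries the exchange matrix up to sign together with the unchanged
  polynomials; this is all that is needed to identify each mutation with
  \<open>exchange_step\<close> on values.\<close>

lemma cluster_pattern_rank2:
  fixes x :: "(2 ratfun, 2) vec"
  assumes free: "free_generating_set x"
    and pal: "reflect_poly Z1 = Z1" "reflect_poly Z2 = Z2"
    and nonzero: "\<And>t. fst (foldr (exchange_step b c Z1 Z2) t (1, 1)) \<noteq> 0 \<and>
                   snd (foldr (exchange_step b c Z1 Z2) t (1, 1)) \<noteq> 0"
  defines "s \<equiv> \<lambda>t. cluster_pattern (rank2_seed x b c Z1 Z2) t"
  shows "polys (s t) = vector [Z1, Z2] \<and>
    (exch (s t) = vector [vector [0, int b], vector [- int c, 0]] \<or>
     exch (s t) = vector [vector [0, - int b], vector [int c, 0]]) \<and>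
    specializes_to x 1 (cluster (s t) $ 1) (fst (foldr (exchange_step b c Z1 Z2) t (1, 1))) \<and>
    specializes_to x 1 (cluster (s t) $ 2) (snd (foldr (exchange_step b c Z1 Z2) t (1, 1)))"
proof (induction t)
  case Nil
  show ?case
    using specializes_to_var[of x 1 1] specializes_to_var[of x 1 2]
    by (simp add: s_def rank2_seed_def)
next
  case (Cons k t)
  define u v where uv: "u = fst (foldr (exchange_step b c Z1 Z2) t (1, 1))"
    "v = snd (foldr (exchange_step b c Z1 Z2) t (1, 1))"
  have nz: "u \<noteq> 0" "v \<noteq> 0"
    using nonzero[of t] by (simp_all add: uv)
  have st: "s (k # t) = mutate k (s t)"
    by (simp add: s_def)
  have polys: "polys (s t) = vector [Z1, Z2]"
    and exch: "exch (s t) = vector [vector [0, int b], vector [- int c, 0]] \<or>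
     exch (s t) = vector [vector [0, - int b], vector [int c, 0]]"
    and spec: "specializes_to x 1 (cluster (s t) $ 1) u" "specializes_to x 1 (cluster (s t) $ 2) v"
    using Cons by (simp_all add: uv)
  have k: "k = 1 \<or> k = 2"
    by (rule exhaust_2)
  have "polys (s (k # t)) = vector [Z1, Z2]"
    using k by (auto simp: st mutate_def mutate_polys_def polys pal vec_2_eq_iff)
  \<comment> \<open>Every off-diagonal entry lies in row or column \<open>k\<close> and is negated.
    At the diagonal entry outside them, the two correction terms vanish or cancel.\<close>
  moreover have "exch (s (k # t)) = vector [vector [0, int b], vector [- int c, 0]] \<or>
     exch (s (k # t)) = vector [vector [0, - int b], vector [int c, 0]]"
    using k exch by (auto simp: st mutate_def mutate_exch_def Let_def vec_2_eq_iff)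
  moreover have "specializes_to x 1 (cluster (s (k # t)) $ j)
    (if j = k
     then (\<Prod>i\<in>UNIV. (vector [u, v] $ i) powi pos_part (- (exch (s t) $ i $ k))) ^ dg (s t) k *
          poly (polys (s t) $ k) (\<Prod>i\<in>UNIV. (vector [u, v] $ i) powi (exch (s t) $ i $ k)) /
            vector [u, v] $ k
     else vector [u, v] $ j)" for j
  proof -
    have "\<forall>i. specializes_to x 1 (cluster (s t) $ i) ((vector [u, v] :: real^2) $ i)"
      "\<forall>i. (vector [u, v] :: real^2) $ i \<noteq> 0"
      using spec nz by (simp_all add: forall_2)
    then show ?thesis
      using specializes_to_mutate_cluster[OF free, of 1 "s t" "vector [u, v]" k j]
      by (simp add: st mutate_def)
  qed
  note this[of 1] this[of 2]
  moreover have step: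
    "foldr (exchange_step b c Z1 Z2) (k # t) (1, 1) = exchange_step b c Z1 Z2 k (u, v)"
    by (simp add: uv)
  ultimately show ?case
    unfolding step
    \<comment> \<open>If the off-diagonal entry of column \<open>k\<close> is negative, the monomial
      prefactor turns \<open>Z(1/w)\<close> into \<open>Z(w)\<close> by palindromicity; otherwise
      the prefactor is 1.\<close>
    using k exch nz palindromic_poly_inverse[OF pal(1), of "v ^ c"]
      palindromic_poly_inverse[OF pal(2), of "u ^ b"]
    by (auto simp: exchange_step_def prod_UNIV_2 polys dg_def power_int_minus)
qed

text \<open>Descent along \<open>m\<close> writes every point as a word over the labels; since each \<open>F k\<close> is an
  involution, a step that repeats the first letter cancels it instead.\<close>

lemma involution_orbit_eq:
  fixes m :: "'p \<Rightarrow> nat"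
  assumes root: "r \<in> S"
    and closed: "\<And>k p. p \<in> S \<Longrightarrow> F k p \<in> S"
    and invol: "\<And>k p. p \<in> S \<Longrightarrow> F k (F k p) = p"
    and descent: "\<And>p. p \<in> S \<Longrightarrow> p \<noteq> r \<Longrightarrow> \<exists>k. m (F k p) < m p"
  shows "{foldr F t r | t. t \<in> tree_vertices} = S"
proof -
  have in_S: "foldr F t r \<in> S" for t
    by (induction t) (simp_all add: root closed)
  have "\<exists>t\<in>tree_vertices. foldr F t r = p" if "p \<in> S" for p
    using that
  proof (induction "m p" arbitrary: p rule: less_induct)
    case less
    show ?case
    proof (cases "p = r")
      case True
      then show ?thesis by (intro bexI[of _ "[]"]) (simp_all add: tree_vertices_def)
    next
      case False
      then obtain k where "m (F k p) < m p"
        using descent less.prems by blast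
      then obtain t where t: "t \<in> tree_vertices" "foldr F t r = F k p"
        using less closed by blast
      then have p: "F k (foldr F t r) = p"
        by (simp add: invol less.prems)
      show ?thesis
      proof (cases "\<exists>t'. t = k # t'")
        case True
        then obtain t' where "t = k # t'" by blast
        then have "foldr F t' r = p"
          using p in_S[of t'] by (simp add: invol)
        then show ?thesis
          using t(1) \<open>t = k # t'\<close>
          by (intro bexI[of _ t']) (auto simp: tree_vertices_def distinct_adj_Cons)
      next
        case False
        with t p show ?thesis
          by (intro bexI[of _ "k # t"]) (cases t; auto simp: tree_vertices_def)+
      qed
    qed
  qed
  with in_S show ?thesis by blast
qed

text \<open>Reduction to arithmetic: \<open>step1\<close> and \<open>step2\<close> ask that the
  conjugate root be a positive integer solution again, and \<open>descent\<close> that one of the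
  two conjugates be smaller, expressed through the product of the roots.\<close>

lemma clusters_give_solutionsI:
  fixes x :: "(2 ratfun, 2) vec" and P Q :: "int \<Rightarrow> int"
  assumes free: "free_generating_set x"
    and pal: "reflect_poly Z1 = Z1" "reflect_poly Z2 = Z2"
    and P: "\<And>v. poly Z1 (of_int v ^ c) = of_int (P v)"
    and Q: "\<And>u. poly Z2 (of_int u ^ b) = of_int (Q u)"
    and root: "E 1 1"
    and step1: "\<And>u v. 0 < u \<Longrightarrow> 0 < v \<Longrightarrow> E u v \<Longrightarrow> \<exists>u'>0. u * u' = P v \<and> E u' v"
    and step2: "\<And>u v. 0 < u \<Longrightarrow> 0 < v \<Longrightarrow> E u v \<Longrightarrow> \<exists>v'>0. v * v' = Q u \<and> E u v'"
    and descent: "\<And>u v. 0 < u \<Longrightarrow> 0 < v \<Longrightarrow> E u v \<Longrightarrow> (u, v) \<noteq> (1, 1) \<Longrightarrow>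
      P v < u * u \<or> Q u < v * v"
  shows "clusters_give_solutions (rank2_seed x b c Z1 Z2) E"
proof -
  let ?F = "exchange_step b c Z1 Z2"
  define S :: "(real \<times> real) set" where "S = {(of_int u, of_int v) | u v. 0 < u \<and> 0 < v \<and> E u v}"
  \<comment> \<open>The product relations are kept along with the new solution: they give both
    involutivity and the size of the new coordinate.\<close>
  have step: "\<exists>u' v'. ?F k (of_int u, of_int v) = (of_int u', of_int v') \<and> 0 < u' \<and> 0 < v' \<and>
      E u' v' \<and> (if k = 1 then u * u' = P v \<and> v' = v else v * v' = Q u \<and> u' = u)"
    if "0 < u" "0 < v" "E u v" for k u v
  proof (cases "k = 1")
    case True
    obtain u' where u': "u' > 0" "u * u' = P v" "E u' v"
      using step1[OF \<open>0 < u\<close> \<open>0 < v\<close> \<open>E u v\<close>] by blast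
    moreover have "of_int (P v) / of_int u = (of_int u' :: real)"
      using \<open>0 < u\<close> by (simp flip: u'(2))
    ultimately show ?thesis
      using True that by (intro exI[of _ u'] exI[of _ v]) (simp add: exchange_step_def P)
  next
    case False
    obtain v' where v': "v' > 0" "v * v' = Q u" "E u v'"
      using step2[OF \<open>0 < u\<close> \<open>0 < v\<close> \<open>E u v\<close>] by blast
    moreover have "of_int (Q u) / of_int v = (of_int v' :: real)"
      using \<open>0 < v\<close> by (simp flip: v'(2))
    ultimately show ?thesis
      using False that by (intro exI[of _ u] exI[of _ v']) (simp add: exchange_step_def Q)
  qed
  have orbit: "{foldr ?F t (1, 1) | t. t \<in> tree_vertices} = S"
  \<comment> \<open>Descent is on the sum of the coordinates; points of \<open>S\<close> are pairs
    of reals with integer values, so the floor only changes the type.\<close>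
  proof (rule involution_orbit_eq[where m = "\<lambda>p. nat \<lfloor>fst p + snd p\<rfloor>"])
    show "(1, 1) \<in> S"
      using root unfolding S_def by (auto intro!: exI[of _ 1])
  next
    fix k p assume "p \<in> S"
    then obtain u v where p: "p = (of_int u, of_int v)" "0 < u" "0 < v" "E u v"
      unfolding S_def by blast
    obtain u' v' where uv': "?F k p = (of_int u', of_int v')" "0 < u'" "0 < v'" "E u' v'"
      "if k = 1 then u * u' = P v \<and> v' = v else v * v' = Q u \<and> u' = u"
      using step[OF p(2-4), of k] p(1) by auto
    then show "?F k p \<in> S"
      unfolding S_def by blast
    show "?F k (?F k p) = p"
    proof (cases "k = 1")
      case True
      then have "P v = u * u'" "v' = v" using uv'(5) by auto
      with True show ?thesis
        using uv'(2) by (simp add: uv'(1)) (simp add: exchange_step_def P p)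
    next
      case False
      then have "Q u = v * v'" "u' = u" using uv'(5) by auto
      with False show ?thesis
        using uv'(3) by (simp add: uv'(1)) (simp add: exchange_step_def Q p)
    qed
  next
    fix p assume "p \<in> S" and "p \<noteq> (1, 1)"
    then obtain u v where p: "p = (of_int u, of_int v)" "0 < u" "0 < v" "E u v" "(u, v) \<noteq> (1, 1)"
      unfolding S_def by auto
    from descent[OF p(2-5)] show "\<exists>k. nat \<lfloor>fst (?F k p) + snd (?F k p)\<rfloor> < nat \<lfloor>fst p + snd p\<rfloor>"
    proof
      assume less: "P v < u * u"
      obtain u' v' where "?F 1 p = (of_int u', of_int v')" "0 < u'" "u * u' = P v" "v' = v"
        using step[OF p(2-4), of 1] p(1) by auto
      moreover from this less have "u' < u"
        using p(2) by (metis mult_less_cancel_left_pos)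
      ultimately show ?thesis
        using p by (intro exI[of _ 1]) (simp flip: of_int_add)
    next
      assume less: "Q u < v * v"
      obtain u' v' where "?F 2 p = (of_int u', of_int v')" "0 < v'" "v * v' = Q u" "u' = u"
        using step[OF p(2-4), of 2] p(1) by auto
      moreover from this less have "v' < v"
        using p(3) by (metis mult_less_cancel_left_pos)
      ultimately show ?thesis
        using p by (intro exI[of _ 2]) (simp flip: of_int_add)
    qed
  qed
  \<comment> \<open>\<open>orbit\<close> speaks of reduced words only, while the induction along the
    pattern asks for nonzero values at every word.\<close>
  have "foldr ?F t (1, 1) \<in> S" for t
  proof (induction t)
    case Nil
    show ?case using root unfolding S_def by (auto intro!: exI[of _ 1])
  next
    case (Cons k t)
    then show ?case using step unfolding S_def by fastforce
  qed
  then have nz: "fst (foldr ?F t (1, 1)) \<noteq> 0 \<and> snd (foldr ?F t (1, 1)) \<noteq> 0" for t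
    unfolding S_def by (smt (verit) mem_Collect_eq fst_conv snd_conv of_int_eq_0_iff)
  note spec = cluster_pattern_rank2[OF free pal nz]
  have "specialize x 1 (cluster (cluster_pattern (rank2_seed x b c Z1 Z2) t) $ 1) =
      fst (foldr ?F t (1, 1))"
    "specialize x 1 (cluster (cluster_pattern (rank2_seed x b c Z1 Z2) t) $ 2) =
      snd (foldr ?F t (1, 1))" for t
    using spec[of t] by (auto intro: specialize_eqI[OF free])
  moreover have "regular_at x 1 (cluster (cluster_pattern (rank2_seed x b c Z1 Z2) t) $ i)" for t i
    using spec[of t] exhaust_2[of i] unfolding regular_at_def by auto
  moreover have "cluster (rank2_seed x b c Z1 Z2) = x"
    by (simp add: rank2_seed_def)
  ultimately show ?thesis
    unfolding clusters_give_solutions_def using orbit by (simp add: S_def)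
qed

section \<open>The Diophantine equations\<close>

text \<open>Vieta: for fixed \<open>v\<close> the equation is monic quadratic in \<open>u\<close>,
  with root sum \<open>(3 + k + l) * v - k\<close> and root product \<open>v^2 + l * v + 1\<close>.
  The conjugate root is an integer by the sum and positive by the product.\<close>

lemma quadric_exchange:
  fixes u v k l :: int
  assumes "0 < u" "0 < v" "0 \<le> l"
    and eq: "u^2 + v^2 + k * u + l * v + 1 = (3 + k + l) * u * v"
  shows "\<exists>u'>0. u * u' = v^2 + l * v + 1 \<and>
    u'^2 + v^2 + k * u' + l * v + 1 = (3 + k + l) * u' * v"
proof (intro exI conjI)
  let ?u' = "(3 + k + l) * v - k - u"
  show prod: "u * ?u' = v^2 + l * v + 1"
    using eq by (simp add: algebra_simps power2_eq_square)
  have "0 < v^2 + l * v + 1"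
    using assms(2,3) by (intro add_nonneg_pos add_nonneg_nonneg) simp_all
  with prod \<open>0 < u\<close> show "0 < ?u'"
    by (metis zero_less_mult_pos)
  have "?u'^2 + k * ?u' - (3 + k + l) * ?u' * v = - (u * ?u')"
    by (simp add: algebra_simps power2_eq_square)
  with prod show "?u'^2 + v^2 + k * ?u' + l * v + 1 = (3 + k + l) * ?u' * v"
    by linarith
qed

text \<open>As a polynomial in \<open>u\<close>, the equation is nonpositive at \<open>u = v\<close>, so \<open>v\<close> separates its roots
  and the root conjugate to \<open>u\<close> is smaller than \<open>u\<close>.\<close>

lemma quadric_descent_less:
  fixes u v k l :: int
  assumes "0 < v" "v < u" "0 \<le> k" "0 \<le> l"
    and eq: "u^2 + v^2 + k * u + l * v + 1 = (3 + k + l) * u * v"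
  shows "v^2 + l * v + 1 < u * u"
proof -
  define u' where "u' = (3 + k + l) * v - k - u"
  have prod: "u * u' = v^2 + l * v + 1"
    using eq by (simp add: u'_def algebra_simps power2_eq_square)
  \<comment> \<open>With \<open>u\<close> and \<open>u'\<close> the roots of the monic quadratic,
    this product is its value at \<open>v\<close>.\<close>
  have "(u - v) * (u' - v) = u * u' - v * (u + u') + v * v"
    by (simp add: algebra_simps)
  also have "\<dots> = - ((v - 1) * ((1 + k + l) * v + 1))"
    unfolding prod by (simp add: u'_def algebra_simps power2_eq_square)
  also have "\<dots> \<le> 0"
    using assms by simp
  finally have "u' \<le> v"
    using \<open>v < u\<close> by (simp add: mult_le_0_iff)
  then have "u * u' < u * u"
    using assms by simp
  with prod show ?thesis by simp
qed

text \<open>On the diagonal the equation factors, with \<open>v - 1\<close> as the only factor that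
  can vanish for positive \<open>v\<close>.\<close>

lemma quadric_diagonal:
  fixes v k l :: int
  assumes "0 < v" "0 \<le> k" "0 \<le> l"
    and eq: "v^2 + v^2 + k * v + l * v + 1 = (3 + k + l) * v * v"
  shows "v = 1"
proof -
  have "(v - 1) * ((1 + k + l) * v + 1) = 0"
    using eq by (simp add: algebra_simps power2_eq_square)
  moreover have "0 < (1 + k + l) * v + 1"
    using assms by (intro add_nonneg_pos mult_nonneg_nonneg) simp_all
  ultimately show ?thesis by simp
qed

text \<open>The larger coordinate can be decreased. Exchanging \<open>u\<close> with
  \<open>v\<close> and \<open>k\<close> with \<open>l\<close> preserves the equation, so one
  inequality serves both off-diagonal cases; the diagonal contains only the root.\<close>

lemma quadric_descent:
  fixes u v k l :: int
  assumes "0 < u" "0 < v" "0 \<le> k" "0 \<le> l" "(u, v) \<noteq> (1, 1)"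
    and eq: "u^2 + v^2 + k * u + l * v + 1 = (3 + k + l) * u * v"
  shows "v^2 + l * v + 1 < u * u \<or> u^2 + k * u + 1 < v * v"
proof -
  have eq': "v^2 + u^2 + l * v + k * u + 1 = (3 + l + k) * v * u"
    using eq by (simp add: algebra_simps)
  consider "v < u" | "u < v" | "u = v" by linarith
  then show ?thesis
  proof cases
    case 3
    then have "v = 1"
      using quadric_diagonal[of v k l] assms by simp
    with 3 assms show ?thesis by simp
  qed (use quadric_descent_less[OF _ _ _ _ eq] quadric_descent_less[OF _ _ _ _ eq'] assms in auto)
qed

text \<open>Common form of the three quadratic equations. Only the composites of the exchange
  polynomials with the powers from the matrix matter, so \<open>1 + u\<close> with exponent 2 and
  \<open>1 + u^2\<close> with exponent 1 act alike.\<close>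

lemma clusters_give_solutions_quadric:
  fixes x :: "(2 ratfun, 2) vec" and k1 k2 :: nat
  assumes "free_generating_set x" "reflect_poly Z1 = Z1" "reflect_poly Z2 = Z2"
    and "\<And>v. poly Z1 (of_int v ^ c) = of_int (v^2 + int k2 * v + 1)"
    and "\<And>u. poly Z2 (of_int u ^ b) = of_int (u^2 + int k1 * u + 1)"
  shows "clusters_give_solutions (rank2_seed x b c Z1 Z2)
    (\<lambda>u v. u^2 + v^2 + int k1 * u + int k2 * v + 1 = (3 + int k1 + int k2) * u * v)"
proof (rule clusters_give_solutionsI[OF assms])
  fix u v :: int
  assume pos: "0 < u" "0 < v"
    and eq: "u^2 + v^2 + int k1 * u + int k2 * v + 1 = (3 + int k1 + int k2) * u * v"
  show "\<exists>u'>0. u * u' = v^2 + int k2 * v + 1 \<and>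
      u'^2 + v^2 + int k1 * u' + int k2 * v + 1 = (3 + int k1 + int k2) * u' * v"
    using quadric_exchange[OF pos _ eq] by simp
  show "\<exists>v'>0. v * v' = u^2 + int k1 * u + 1 \<and>
      u^2 + v'^2 + int k1 * u + int k2 * v' + 1 = (3 + int k1 + int k2) * u * v'"
    using quadric_exchange[of v u "int k1" "int k2"] pos eq by (simp add: algebra_simps)
  show "v^2 + int k2 * v + 1 < u * u \<or> u^2 + int k1 * u + 1 < v * v" if "(u, v) \<noteq> (1, 1)"
    using quadric_descent[OF pos _ _ that eq] by simp
qed simp

text \<open>The quartic equation in \<open>(u, v)\<close> is the quadratic one in \<open>(u, v\<^sup>2)\<close> with \<open>k1 = 2\<close>.  There the
  exchange relation for the second variable reads \<open>V V' = (u + 1)\<^sup>2\<close>, so \<open>v\<^sup>2\<close> divides \<open>(u + 1)\<^sup>2\<close>,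
  whence \<open>v\<close> divides \<open>u + 1\<close>.\<close>

lemma clusters_give_solutions_quartic:
  fixes x :: "(2 ratfun, 2) vec" and k :: nat
  assumes "free_generating_set x" "reflect_poly Z1 = Z1" "reflect_poly Z2 = Z2"
    and "\<And>v. poly Z1 (of_int v ^ c) = of_int (v^4 + int k * v^2 + 1)"
    and "\<And>u. poly Z2 (of_int u ^ b) = of_int (u + 1)"
  shows "clusters_give_solutions (rank2_seed x b c Z1 Z2)
    (\<lambda>u v. u^2 + v^4 + int k * v^2 + 2 * u + 1 = (5 + int k) * u * v^2)"
proof (rule clusters_give_solutionsI[OF assms])
  have quadric: "u^2 + v^4 + int k * v^2 + 2 * u + 1 = (5 + int k) * u * v^2 \<longleftrightarrow>
      u^2 + (v^2)^2 + 2 * u + int k * v^2 + 1 = (3 + 2 + int k) * u * v^2" for u v :: int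
    by (simp add: power_mult[symmetric] algebra_simps)
  fix u v :: int
  assume pos: "0 < u" "0 < v"
    and eq: "u^2 + v^4 + int k * v^2 + 2 * u + 1 = (5 + int k) * u * v^2"
  have pos2: "0 < v^2" using pos by simp
  note eq2 = eq[unfolded quadric]
  show "\<exists>u'>0. u * u' = v^4 + int k * v^2 + 1 \<and>
      u'^2 + v^4 + int k * v^2 + 2 * u' + 1 = (5 + int k) * u' * v^2"
    using quadric_exchange[OF pos(1) pos2 _ eq2] unfolding quadric
    by (simp add: power_mult[symmetric])
  \<comment> \<open>The second factor is the conjugate of \<open>v^2\<close>, read off from the sum
    of the roots.\<close>
  have eq3: "v^2 * ((5 + int k) * u - int k - v^2) = (u + 1)^2"
    using eq by (simp add: algebra_simps power2_eq_square power4_eq_xxxx)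
  then have "v^2 dvd (u + 1)^2"
    by (metis dvd_triv_left)
  then obtain v' where v': "u + 1 = v * v'"
    by (auto simp: pow_divides_pow_iff)
  have "0 < v'"
    using v' pos by (metis add_pos_pos zero_less_mult_pos zero_less_one)
  \<comment> \<open>Cancelling \<open>v^2\<close> shows that the conjugate root is the perfect
    square \<open>v'^2\<close>. The root sum is symmetric in \<open>v\<close> and \<open>v'\<close>,
    so \<open>eq3\<close> then holds with \<open>v'\<close> for \<open>v\<close>, which is the
    equation at \<open>(u, v')\<close>.\<close>
  have "v^2 * ((5 + int k) * u - int k - v^2) = v^2 * v'^2"
    using eq3 by (simp add: v' power_mult_distrib)
  then have "(5 + int k) * u - int k - v^2 = v'^2"
    using pos by simp
  then have "(5 + int k) * u - int k - v'^2 = v^2"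
    by simp
  then have "v'^2 * ((5 + int k) * u - int k - v'^2) = (u + 1)^2"
    by (simp add: v' power_mult_distrib mult.commute)
  then have "u^2 + v'^4 + int k * v'^2 + 2 * u + 1 = (5 + int k) * u * v'^2"
    by (simp add: algebra_simps power2_eq_square power4_eq_xxxx)
  with v' \<open>0 < v'\<close> show "\<exists>v'>0. v * v' = u + 1 \<and>
      u^2 + v'^4 + int k * v'^2 + 2 * u + 1 = (5 + int k) * u * v'^2"
    by auto
  show "v^4 + int k * v^2 + 1 < u * u \<or> u + 1 < v * v" if "(u, v) \<noteq> (1, 1)"
  proof -
    have "(u, v^2) \<noteq> (1, 1)"
      using that pos by (auto simp: power2_eq_1_iff)
    then have "(v^2)^2 + int k * v^2 + 1 < u * u \<or> u^2 + 2 * u + 1 < v^2 * v^2"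
      using quadric_descent[OF pos(1) pos2 _ _ _ eq2] by simp
    \<comment> \<open>The quadratic descent compares squares in the second variable; taking square
      roots returns to the exchange relation \<open>v * v' = u + 1\<close>.\<close>
    moreover have "u + 1 < v * v" if "u^2 + 2 * u + 1 < v^2 * v^2"
    proof -
      have "(u + 1)^2 < (v * v)^2"
        using that by (simp add: power2_eq_square algebra_simps)
      then show ?thesis
        by (rule power_less_imp_less_base) simp
    qed
    ultimately show ?thesis
      by (auto simp: power_mult[symmetric])
  qed
qed simp

section \<open>The five cases\<close>

lemma reflect_poly_palindromes:
  "reflect_poly [:1, 1:] = [:1, 1 :: real:]"
  "reflect_poly [:1, a, 1:] = [:1, a, 1 :: real:]"
  by (simp_all add: reflect_poly_pCons cCons_def)

theorem theorem5p4:
  fixes k k1 k2 :: nat and x :: "(2 ratfun, 2) vec"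
  assumes "free_generating_set x"
  shows "clusters_give_solutions
      \<lparr>cluster = x,
       exch = vector [vector [0, 2], vector [-2, 0]],
       polys = vector [[:1, 1:], [:1, 1:]]\<rparr>
      (\<lambda>a b. a^2 + b^2 + 1 = 3 * a * b) \<and>
    clusters_give_solutions
      \<lparr>cluster = x,
       exch = vector [vector [0, 1], vector [-2, 0]],
       polys = vector [[:1, 1:], [:1, of_nat k1, 1:]]\<rparr>
      (\<lambda>a b. a^2 + b^2 + int k1 * a + 1 = (3 + int k1) * a * b) \<and>
    clusters_give_solutions
      \<lparr>cluster = x,
       exch = vector [vector [0, 1], vector [-1, 0]],
       polys = vector [[:1, of_nat k2, 1:], [:1, of_nat k1, 1:]]\<rparr>
      (\<lambda>a b. a^2 + b^2 + int k1 * a + int k2 * b + 1 = (3 + int k1 + int k2) * a * b) \<and>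
    clusters_give_solutions
      \<lparr>cluster = x,
       exch = vector [vector [0, 1], vector [-4, 0]],
       polys = vector [[:1, 1:], [:1, 1:]]\<rparr>
      (\<lambda>a b. a^2 + b^4 + 2 * a + 1 = 5 * a * b^2) \<and>
    clusters_give_solutions
      \<lparr>cluster = x,
       exch = vector [vector [0, 1], vector [-2, 0]],
       polys = vector [[:1, of_nat k, 1:], [:1, 1:]]\<rparr>
      (\<lambda>a b. a^2 + b^4 + int k * b^2 + 2 * a + 1 = (5 + int k) * a * b^2)"
proof (intro conjI)
  note pal = reflect_poly_palindromes
  note quadric = clusters_give_solutions_quadric[OF assms, unfolded rank2_seed_def]
    and quartic = clusters_give_solutions_quartic[OF assms, unfolded rank2_seed_def]
  show "clusters_give_solutions
      \<lparr>cluster = x, exch = vector [vector [0, 2], vector [-2, 0]],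
       polys = vector [[:1, 1:], [:1, 1:]]\<rparr>
      (\<lambda>a b. a^2 + b^2 + 1 = 3 * a * b)"
    \<comment> \<open>The numerical parameters are, in order, \<open>c\<close>, \<open>k2\<close>,
      \<open>b\<close>, \<open>k1\<close>; evaluating \<open>1 + u\<close> at a square leaves no
      linear term.\<close>
    using quadric[of "[:1, 1:]" "[:1, 1:]" 2 0 2 0] by (simp add: pal)
  show "clusters_give_solutions
      \<lparr>cluster = x, exch = vector [vector [0, 1], vector [-2, 0]],
       polys = vector [[:1, 1:], [:1, of_nat k1, 1:]]\<rparr>
      (\<lambda>a b. a^2 + b^2 + int k1 * a + 1 = (3 + int k1) * a * b)"
    using quadric[of "[:1, 1:]" "[:1, of_nat k1, 1:]" 2 0 1 k1]
    by (simp add: pal algebra_simps power2_eq_square)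
  show "clusters_give_solutions
      \<lparr>cluster = x, exch = vector [vector [0, 1], vector [-1, 0]],
       polys = vector [[:1, of_nat k2, 1:], [:1, of_nat k1, 1:]]\<rparr>
      (\<lambda>a b. a^2 + b^2 + int k1 * a + int k2 * b + 1 = (3 + int k1 + int k2) * a * b)"
    using quadric[of "[:1, of_nat k2, 1:]" "[:1, of_nat k1, 1:]" 1 k2 1 k1]
    by (simp add: pal algebra_simps power2_eq_square)
  show "clusters_give_solutions
      \<lparr>cluster = x, exch = vector [vector [0, 1], vector [-4, 0]],
       polys = vector [[:1, 1:], [:1, 1:]]\<rparr>
      (\<lambda>a b. a^2 + b^4 + 2 * a + 1 = 5 * a * b^2)"
    \<comment> \<open>Here the order is \<open>c\<close>, \<open>k\<close>, \<open>b\<close>: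
      \<open>1 + u\<close> at \<open>v^4\<close> has no middle term, so
      \<open>k = 0\<close>.\<close>
    using quartic[of "[:1, 1:]" "[:1, 1:]" 4 0 1] by (simp add: pal)
  show "clusters_give_solutions
      \<lparr>cluster = x, exch = vector [vector [0, 1], vector [-2, 0]],
       polys = vector [[:1, of_nat k, 1:], [:1, 1:]]\<rparr>
      (\<lambda>a b. a^2 + b^4 + int k * b^2 + 2 * a + 1 = (5 + int k) * a * b^2)"
    using quartic[of "[:1, of_nat k, 1:]" "[:1, 1:]" 2 k 1]
    by (simp add: pal algebra_simps power2_eq_square power4_eq_xxxx)
qed

end
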